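(* Let $I$ be the edge graph of the regular icosahedron and $C$ the edge graph of the cube, both viewed as metric graphs with every edge of length $1$. There is no isometric covering $m:I\to C$.
   Context: A metric graph is viewed as a metric space in which each edge is a segment of its length, glued at the vertices. An isometric covering of $Y$ by $X$ is a surjective map $m:X\to Y$ such that, for every path $p$ in $X$, the arc length of $p$ equals the arc length of the curve $m(p)$ in $Y$, counted with multiplicity. *)

theory Defs
  imports "HOL-Analysis.Analysis"
begin

text \<open>A finite graph is given by a vertex set V of naturals and a symmetric adjacency
relation E. Its metric graph has as points the vertices and, for every edge {u,v} with
u < v, the interior points Mid u v t (0 < t < 1), at distance t from u and 1 - t from v.
Each point is represented exactly once.\<close>

datatype gpt = Vert nat | Mid nat nat real

definition mg_points :: "nat set \<Rightarrow> (nat \<Rightarrow> nat \<Rightarrow> bool) \<Rightarrow> gpt set" where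
  "mg_points V E = {Vert v | v. v \<in> V} \<union>
     {Mid u v t | u v t. u \<in> V \<and> v \<in> V \<and> u < v \<and> E u v \<and> 0 < t \<and> t < 1}"

definition gdist :: "(nat \<Rightarrow> nat \<Rightarrow> bool) \<Rightarrow> nat \<Rightarrow> nat \<Rightarrow> nat" where
  "gdist E u v = (LEAST n. \<exists>w::nat \<Rightarrow> nat. w 0 = u \<and> w n = v \<and> (\<forall>i<n. E (w i) (w (Suc i))))"

fun ends :: "gpt \<Rightarrow> (nat \<times> real) set" where
  "ends (Vert v) = {(v, 0)}"
| "ends (Mid u v t) = {(u, t), (v, 1 - t)}"

fun same_edge_dist :: "gpt \<Rightarrow> gpt \<Rightarrow> real set" where
  "same_edge_dist (Mid u v s) (Mid u' v' t) = (if u = u' \<and> v = v' then {\<bar>s - t\<bar>} else {})"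
| "same_edge_dist _ _ = {}"

definition mg_dist :: "(nat \<Rightarrow> nat \<Rightarrow> bool) \<Rightarrow> gpt \<Rightarrow> gpt \<Rightarrow> real" where
  "mg_dist E p q = Min (same_edge_dist p q \<union>
     {a + real (gdist E x y) + b | x a y b. (x, a) \<in> ends p \<and> (y, b) \<in> ends q})"

definition is_path :: "('a \<Rightarrow> 'a \<Rightarrow> real) \<Rightarrow> 'a set \<Rightarrow> (real \<Rightarrow> 'a) \<Rightarrow> bool" where
  "is_path d S p \<longleftrightarrow> (\<forall>t\<in>{0..1}. p t \<in> S) \<and>
     (\<forall>t\<in>{0..1}. \<forall>e>0. \<exists>\<delta>>0. \<forall>s\<in>{0..1}. \<bar>s - t\<bar> < \<delta> \<longrightarrow> d (p s) (p t) < e)"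

definition partitions01 :: "real list set" where
  "partitions01 = {ts. ts \<noteq> [] \<and> sorted ts \<and> hd ts = 0 \<and> last ts = 1}"

text \<open>Arc length (total variation) of a curve parametrized on [0,1]; this counts multiplicity.\<close>
definition arc_length :: "('a \<Rightarrow> 'a \<Rightarrow> real) \<Rightarrow> (real \<Rightarrow> 'a) \<Rightarrow> ereal" where
  "arc_length d p = (SUP ts \<in> partitions01.
      ereal (\<Sum>i < length ts - 1. d (p (ts ! i)) (p (ts ! Suc i))))"

definition isometric_covering ::
  "'a set \<Rightarrow> ('a \<Rightarrow> 'a \<Rightarrow> real) \<Rightarrow> 'b set \<Rightarrow> ('b \<Rightarrow> 'b \<Rightarrow> real) \<Rightarrow> ('a \<Rightarrow> 'b) \<Rightarrow> bool" where
  "isometric_covering X dX Y dY m \<longleftrightarrow>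
     m ` X = Y \<and>
     (\<forall>p. is_path dX X p \<longrightarrow> arc_length dY (m \<circ> p) = arc_length dX p)"

text \<open>Icosahedron: apex 0, upper pentagon 1..5, lower pentagon 6..10, apex 11;
an antiprism between the pentagons, capped by the two apices (30 edges).\<close>
definition ico_edges :: "(nat \<times> nat) set" where
  "ico_edges =
     {(0, i) | i. i \<in> {1..5}} \<union>
     {(i, i mod 5 + 1) | i. i \<in> {1..5}} \<union>
     {(5 + i, 5 + (i mod 5 + 1)) | i. i \<in> {1..5}} \<union>
     {(i, 5 + i) | i. i \<in> {1..5}} \<union>
     {(i, 5 + (i mod 5 + 1)) | i. i \<in> {1..5}} \<union>
     {(11, j) | j. j \<in> {6..10}}"

definition ico_V :: "nat set" where "ico_V = {0..11}"
definition ico_adj :: "nat \<Rightarrow> nat \<Rightarrow> bool" where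
  "ico_adj u v \<longleftrightarrow> (u, v) \<in> ico_edges \<or> (v, u) \<in> ico_edges"

definition cube_V :: "nat set" where "cube_V = {0..7}"
definition cube_adj :: "nat \<Rightarrow> nat \<Rightarrow> bool" where
  "cube_adj u v \<longleftrightarrow> u < 8 \<and> v < 8 \<and> (\<exists>k<3. Bit_Operations.xor u v = 2 ^ k)"

end

theory Submission
  imports Defs
begin

text \<open>An isometric covering is 1-Lipschitz along edges. Forgetting one coordinate of the cube
projects it onto a 4-cycle, that is onto \<open>\<real>/4\<int>\<close>, again without increasing distances. Triangles of
the icosahedron have perimeter 3 < 4, so a 1-Lipschitz map into \<open>\<real>/4\<int>\<close> has no winding around them
and lifts to a real-valued 1-Lipschitz map. The icosahedron graph has diameter 3, so the
lift takes values in an interval of length 3 and cannot cover the circle of length 4.\<close>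

section \<open>Lipschitz curves\<close>

lemma is_path_if_lipschitz:
  assumes "\<And>t. t \<in> {0..1} \<Longrightarrow> p t \<in> S"
    and lip: "\<And>s t. s \<in> {0..1} \<Longrightarrow> t \<in> {0..1} \<Longrightarrow> d (p s) (p t) \<le> L * \<bar>s - t\<bar>"
  shows "is_path d S p"
  unfolding is_path_def
proof (intro conjI ballI allI impI)
  fix t e :: real assume t: "t \<in> {0..1}" and e: "e > 0"
  \<comment> \<open>The divisor \<open>\<bar>L\<bar> + 1\<close> is positive for every real
    \<open>L\<close>, so the chosen radius is valid even for \<open>L = 0\<close>.\<close>
  have "d (p s) (p t) < e" if s: "s \<in> {0..1}" "\<bar>s - t\<bar> < e / (\<bar>L\<bar> + 1)" for s
  proof -
    have "L * \<bar>s - t\<bar> \<le> (\<bar>L\<bar> + 1) * \<bar>s - t\<bar>"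
      by (intro mult_right_mono) auto
    also have "\<dots> < e"
      using s(2) by (simp add: field_simps)
    finally show ?thesis
      using lip[OF s(1) t] by simp
  qed
  then show "\<exists>\<delta>>0. \<forall>s\<in>{0..1}. \<bar>s - t\<bar> < \<delta> \<longrightarrow> d (p s) (p t) < e"
    using e by (intro exI[of _ "e / (\<bar>L\<bar> + 1)"]) auto
qed (use assms in auto)

text \<open>Along every partition of [0,1] the Lipschitz bounds telescope to
  \<open>L * (1 - 0)\<close>, so no variation sum exceeds \<open>L\<close>.\<close>

lemma arc_length_le_if_lipschitz:
  assumes lip: "\<And>s t. s \<in> {0..1} \<Longrightarrow> t \<in> {0..1} \<Longrightarrow> d (p s) (p t) \<le> L * \<bar>s - t\<bar>"
  shows "arc_length d p \<le> ereal L"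
  unfolding arc_length_def
proof (rule SUP_least)
  fix ts :: "real list" assume "ts \<in> partitions01"
  then have ne: "ts \<noteq> []" and sorted: "sorted ts"
    and ends: "ts ! 0 = 0" "ts ! (length ts - 1) = 1"
    by (auto simp: partitions01_def hd_conv_nth last_conv_nth)
  have mono: "ts ! i \<le> ts ! j" if "i \<le> j" "j < length ts" for i j
    using sorted that by (simp add: sorted_iff_nth_mono)
  have range: "ts ! i \<in> {0..1}" if "i < length ts" for i
    using mono[of 0 i] mono[of i "length ts - 1"] ends that by auto
  have "(\<Sum>i<length ts - 1. d (p (ts ! i)) (p (ts ! Suc i)))
      \<le> (\<Sum>i<length ts - 1. L * (ts ! Suc i - ts ! i))"
  proof (rule sum_mono)
    fix i assume "i \<in> {..<length ts - 1}"
    then show "d (p (ts ! i)) (p (ts ! Suc i)) \<le> L * (ts ! Suc i - ts ! i)"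
      using lip[OF range range, of i "Suc i"] mono[of i "Suc i"] by (simp add: abs_minus_commute)
  qed
  also have "\<dots> = L * (ts ! (length ts - 1) - ts ! 0)"
    by (simp only: sum_distrib_left[symmetric] sum_lessThan_telescope)
  finally show "ereal (\<Sum>i<length ts - 1. d (p (ts ! i)) (p (ts ! Suc i))) \<le> ereal L"
    using ends by simp
qed

text \<open>The trivial partition \<open>[0, 1]\<close> contributes exactly this distance to the
  supremum.\<close>

lemma dist_endpoints_le_arc_length: "ereal (d (p 0) (p 1)) \<le> arc_length d p"
  unfolding arc_length_def
  by (rule SUP_upper2[of "[0, 1]"]) (auto simp: partitions01_def)

text \<open>Preservation of length turns into a bound on distances: the endpoints of the image are
  no farther apart than the length of \<open>m \<circ> p\<close>, which is the length of
  \<open>p\<close> and hence at most \<open>L\<close>.\<close>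

lemma isometric_covering_lipschitz:
  assumes m: "isometric_covering X dX Y dY m"
    and "\<And>t. t \<in> {0..1} \<Longrightarrow> p t \<in> X"
    and "\<And>s t. s \<in> {0..1} \<Longrightarrow> t \<in> {0..1} \<Longrightarrow> dX (p s) (p t) \<le> L * \<bar>s - t\<bar>"
  shows "dY (m (p 0)) (m (p 1)) \<le> L"
proof -
  have "is_path dX X p"
    using assms(2,3) by (rule is_path_if_lipschitz)
  then have "arc_length dY (m \<circ> p) = arc_length dX p"
    using m by (simp add: isometric_covering_def)
  also have "\<dots> \<le> ereal L"
    using assms(3) by (rule arc_length_le_if_lipschitz)
  finally have "ereal (dY ((m \<circ> p) 0) ((m \<circ> p) 1)) \<le> ereal L"
    using dist_endpoints_le_arc_length[of dY "m \<circ> p"] by (rule order_trans[rotated])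
  then show ?thesis by simp
qed

section \<open>Distances in metric graphs\<close>

lemma gdist_eq_relpowp: "gdist E u v = (LEAST n. (E ^^ n) u v)"
  by (simp add: gdist_def relpowp_fun_conv)

lemma gdist_le: "(E ^^ n) u v \<Longrightarrow> gdist E u v \<le> n"
  unfolding gdist_eq_relpowp by (rule Least_le)

text \<open>Reachability makes the set of walk lengths nonempty, so the \<open>LEAST\<close> in
  \<open>gdist\<close> is attained.\<close>

lemma relpowp_gdist: "E\<^sup>*\<^sup>* u v \<Longrightarrow> (E ^^ gdist E u v) u v"
  unfolding gdist_eq_relpowp using rtranclp_imp_relpowp[of E u v] by (auto intro: LeastI)

lemma gdist_refl [simp]: "gdist E u u = 0"
  using gdist_le[of 0 E u u] by simp

lemma gdist_edge: "E u v \<Longrightarrow> gdist E u v \<le> 1"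
  by (rule gdist_le) (simp add: eq_OO)

lemma finite_ends [simp]: "finite (ends p)"
  by (cases p) auto

lemma ends_nonempty [simp]: "ends p \<noteq> {}"
  by (cases p) auto

lemma finite_same_edge_dist [simp]: "finite (same_edge_dist p q)"
  by (cases p; cases q) auto

text \<open>Written as the image of a finite product, the set of candidate lengths is visibly finite
  and nonempty, which both \<open>Min_le\<close> and \<open>Min_in\<close> require.\<close>

lemma mg_dist_eq:
  "mg_dist E p q = Min (same_edge_dist p q \<union>
     (\<lambda>((x, a), (y, b)). a + real (gdist E x y) + b) ` (ends p \<times> ends q))"
  unfolding mg_dist_def by (rule arg_cong[of _ _ Min]) (force simp: image_iff)

lemma mg_dist_le_via:
  assumes "(x, a) \<in> ends p" "(y, b) \<in> ends q"
  shows "mg_dist E p q \<le> a + real (gdist E x y) + b"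
  unfolding mg_dist_eq by (rule Min_le) (use assms in \<open>force+\<close>)

lemma mg_dist_le_same_edge: "r \<in> same_edge_dist p q \<Longrightarrow> mg_dist E p q \<le> r"
  unfolding mg_dist_eq by (rule Min_le) auto

lemma mg_dist_cases:
  obtains "mg_dist E p q \<in> same_edge_dist p q"
  | x a y b where "(x, a) \<in> ends p" "(y, b) \<in> ends q" "mg_dist E p q = a + real (gdist E x y) + b"
proof -
  have "mg_dist E p q \<in> same_edge_dist p q \<union>
     (\<lambda>((x, a), (y, b)). a + real (gdist E x y) + b) ` (ends p \<times> ends q)"
    unfolding mg_dist_eq by (rule Min_in) auto
  then show thesis using that by auto
qed

text \<open>A closed edge as a segment over [0,1]. The endpoints have to be turned into
  \<open>Vert\<close>, since \<open>Mid\<close> stands for interior points only.\<close>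

definition edge_pt :: "nat \<Rightarrow> nat \<Rightarrow> real \<Rightarrow> gpt" where
  "edge_pt u v t = (if t \<le> 0 then Vert u else if t \<ge> 1 then Vert v else Mid u v t)"

lemma edge_pt_in_mg_points:
  "u \<in> V \<Longrightarrow> v \<in> V \<Longrightarrow> u < v \<Longrightarrow> E u v \<Longrightarrow> edge_pt u v t \<in> mg_points V E"
  by (auto simp: edge_pt_def mg_points_def)

lemma mg_dist_edge_pt_le:
  assumes "E u v" "E v u" "s \<in> {0..1}" "t \<in> {0..1}"
  shows "mg_dist E (edge_pt u v s) (edge_pt u v t) \<le> \<bar>s - t\<bar>"
proof -
  let ?p = "edge_pt u v s" and ?q = "edge_pt u v t"
  have g: "real (gdist E u v) \<le> 1" "real (gdist E v u) \<le> 1"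
    using gdist_edge[of E u v] gdist_edge[of E v u] assms by simp_all
  note via = mg_dist_le_via[of _ _ ?p _ _ ?q E]
  consider "s = 0" | "s = 1" | "0 < s" "s < 1" using assms by force
  then show ?thesis
  proof cases
    case 1
    then show ?thesis
      using via[of u 0 u t] via[of u 0 v 0] via[of u 0 u 0] g assms
      by (auto simp: edge_pt_def split: if_splits)
  next
    case 2
    then show ?thesis
      using via[of v 0 v "1 - t"] via[of v 0 v 0] via[of v 0 u 0] g assms
      by (auto simp: edge_pt_def split: if_splits)
  next
    case 3
    then show ?thesis
      using via[of u s u 0] via[of v "1 - s" v 0]
        mg_dist_le_same_edge[of "\<bar>s - t\<bar>" ?p ?q E] assms
      by (auto simp: edge_pt_def split: if_splits)
  qed
qed

lemma covering_lipschitz_on_edge: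
  assumes m: "isometric_covering (mg_points V E) (mg_dist E) Y dY m"
    and e: "u \<in> V" "v \<in> V" "u < v" "E u v" "E v u"
    and ab: "a \<in> {0..1}" "b \<in> {0..1}"
  shows "dY (m (edge_pt u v a)) (m (edge_pt u v b)) \<le> \<bar>b - a\<bar>"
proof -
  \<comment> \<open>The segment from \<open>a\<close> to \<open>b\<close> traversed at constant
    speed \<open>\<bar>b - a\<bar>\<close> and rescaled to [0,1], the parameter interval of a
    path.\<close>
  define p where "p = (\<lambda>t. edge_pt u v ((1 - t) * a + t * b))"
  have conv: "(1 - t) * a + t * b \<in> {0..1}" if "t \<in> {0..1}" for t
    using convexD_alt[of "{0..1}" a b t] ab that by simp
  have "mg_dist E (p s) (p t) \<le> \<bar>b - a\<bar> * \<bar>s - t\<bar>" if "s \<in> {0..1}" "t \<in> {0..1}" for s t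
  proof -
    have "((1 - s) * a + s * b) - ((1 - t) * a + t * b) = (b - a) * (s - t)"
      by (simp add: algebra_simps)
    then show ?thesis
      using mg_dist_edge_pt_le[where E = E, OF e(4,5) conv[OF that(1)] conv[OF that(2)]]
      by (simp add: p_def abs_mult)
  qed
  moreover have "p t \<in> mg_points V E" for t
    unfolding p_def using e by (intro edge_pt_in_mg_points)
  ultimately have "dY (m (p 0)) (m (p 1)) \<le> \<bar>b - a\<bar>"
    by (intro isometric_covering_lipschitz[OF m])
  then show ?thesis by (simp add: p_def)
qed

section \<open>The circle of length 4\<close>

text \<open>Points of \<real>/4\<int> are handled through real representatives: the relation says
  that their distance on the circle is at most \<open>r\<close>, and \<open>circ_near 0\<close> is
  congruence modulo 4.\<close>

definition circ_near :: "real \<Rightarrow> real \<Rightarrow> real \<Rightarrow> bool" where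
  "circ_near r a b \<longleftrightarrow> (\<exists>k::int. \<bar>a - b + 4 * of_int k\<bar> \<le> r)"

lemma circ_nearI: "\<bar>a - b\<bar> \<le> r \<Longrightarrow> circ_near r a b"
  unfolding circ_near_def by (rule exI[of _ 0]) simp

lemma circ_near_sym: "circ_near r a b \<Longrightarrow> circ_near r b a"
  unfolding circ_near_def
proof (elim exE)
  fix k :: int assume "\<bar>a - b + 4 * of_int k\<bar> \<le> r"
  then show "\<exists>k::int. \<bar>b - a + 4 * of_int k\<bar> \<le> r" by (intro exI[of _ "-k"]) simp
qed

lemma circ_near_trans: "circ_near r a b \<Longrightarrow> circ_near s b c \<Longrightarrow> circ_near (r + s) a c"
  unfolding circ_near_def
proof (elim exE)
  fix k l :: int assume "\<bar>a - b + 4 * of_int k\<bar> \<le> r" "\<bar>b - c + 4 * of_int l\<bar> \<le> s"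
  then show "\<exists>k::int. \<bar>a - c + 4 * of_int k\<bar> \<le> r + s" by (intro exI[of _ "k + l"]) simp
qed

lemma circ_near_mono: "circ_near r a b \<Longrightarrow> r \<le> s \<Longrightarrow> circ_near s a b"
  unfolding circ_near_def by (meson order_trans)

text \<open>Path lifting in one step: shifting \<open>a\<close> by a suitable multiple of 4 brings
  it within \<open>r\<close> of the lift \<open>B\<close> already chosen.\<close>

lemma circ_near_lift:
  assumes "circ_near r a b" "circ_near 0 B b"
  obtains A where "circ_near 0 A a" "\<bar>A - B\<bar> \<le> r"
proof -
  have "circ_near r a B"
    using circ_near_trans[OF assms(1) circ_near_sym[OF assms(2)]] by simp
  then obtain k :: int where "\<bar>a - B + 4 * of_int k\<bar> \<le> r"
    unfolding circ_near_def by blast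
  moreover have "circ_near 0 (a + 4 * of_int k) a"
    unfolding circ_near_def by (rule exI[of _ "-k"]) simp
  ultimately show thesis
    using that[of "a + 4 * of_int k"] by (simp add: algebra_simps)
qed

text \<open>The difference \<open>A - B\<close> is within \<open>r\<close> of some multiple of 4,
  and \<open>\<bar>A - B\<bar> + r < 4\<close> leaves only the multiple 0. This excludes winding
  around the circle.\<close>

lemma circ_near_lift_unique:
  assumes "circ_near r a b" "circ_near 0 A a" "circ_near 0 B b" "\<bar>A - B\<bar> + r < 4"
  shows "\<bar>A - B\<bar> \<le> r"
proof -
  have "circ_near r A B"
    using circ_near_trans[OF assms(2) circ_near_trans[OF assms(1) circ_near_sym[OF assms(3)]]]
    by simp
  then obtain k :: int where k: "\<bar>A - B + 4 * of_int k\<bar> \<le> r"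
    unfolding circ_near_def by blast
  then have "\<bar>of_int k :: real\<bar> < 1" using assms(4) by linarith
  then have "k = 0" by linarith
  with k show ?thesis by simp
qed

section \<open>Projecting the cube to the 4-cycle\<close>

text \<open>The third bit is ignored and the first two are read as a Gray code.\<close>

definition vert_pos :: "nat \<Rightarrow> real" where
  "vert_pos v = [0, 1, 3, 2] ! (v mod 4)"

text \<open>An edge whose vertex positions differ by 3 passes through \<open>0 \<equiv> 4\<close> and is traversed backwards.\<close>

definition edge_dir :: "nat \<Rightarrow> nat \<Rightarrow> real" where
  "edge_dir u v = (if vert_pos v - vert_pos u = 3 then -1 else vert_pos v - vert_pos u)"

text \<open>The projection is affine on each edge. Edges in the direction of the third bit have
  \<open>edge_dir\<close> 0 and collapse to a point; values may leave [0,4), since only the class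
  modulo 4 matters.\<close>

fun circ_pos :: "gpt \<Rightarrow> real" where
  "circ_pos (Vert v) = vert_pos v"
| "circ_pos (Mid u v t) = vert_pos u + t * edge_dir u v"

lemma less_8_cases:
  assumes "(u::nat) < 8"
  obtains "u = 0" | "u = 1" | "u = 2" | "u = 3" | "u = 4" | "u = 5" | "u = 6" | "u = 7"
  using assms by linarith

lemma cube_adj_iff: "cube_adj u v \<longleftrightarrow> u < 8 \<and> v < 8 \<and> Bit_Operations.xor u v \<in> {1, 2, 4}"
proof -
  have "(\<exists>k<3. n = (2::nat) ^ k) \<longleftrightarrow> n \<in> {1, 2, 4}" for n
    by (auto simp: less_Suc_eq numeral_3_eq_3)
  then show ?thesis by (simp add: cube_adj_def)
qed

lemma cube_adj_commute: "cube_adj u v \<longleftrightarrow> cube_adj v u"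
  by (auto simp: cube_adj_iff xor.commute)

lemma edge_dir_cube:
  assumes "cube_adj u v" "u < v"
  shows "\<bar>edge_dir u v\<bar> \<le> 1" "circ_near 0 (vert_pos u + edge_dir u v) (vert_pos v)"
proof -
  have "u < 8" "v < 8" using assms by (auto simp: cube_adj_iff)
  \<comment> \<open>A finite check over all pairs of vertices. The shift by 4 occurs on the edges
    0-2 and 4-6, where position 3 is approached as -1.\<close>
  then have "\<bar>edge_dir u v\<bar> \<le> 1 \<and>
    (vert_pos u + edge_dir u v = vert_pos v \<or> vert_pos u + edge_dir u v = vert_pos v - 4)"
    using assms
    by (elim less_8_cases) (simp_all add: cube_adj_iff vert_pos_def edge_dir_def)
  moreover have "circ_near 0 (x - 4) x" for x
    unfolding circ_near_def by (rule exI[of _ 1]) simp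
  ultimately show "\<bar>edge_dir u v\<bar> \<le> 1" "circ_near 0 (vert_pos u + edge_dir u v) (vert_pos v)"
    by (auto intro: circ_nearI)
qed

lemma vert_pos_cube_adj:
  assumes "cube_adj u v"
  shows "circ_near 1 (vert_pos u) (vert_pos v)"
proof -
  have *: "circ_near 1 (vert_pos u) (vert_pos v)" if "cube_adj u v" "u < v" for u v
    using circ_near_trans[OF circ_nearI edge_dir_cube(2)[OF that], of "vert_pos u" 1]
      edge_dir_cube(1)[OF that] by simp
  have "u \<noteq> v" using assms by (auto simp: cube_adj_iff)
  then show ?thesis
    using *[of u v] circ_near_sym[OF *[of v u]] assms cube_adj_commute by (meson nat_neq_iff)
qed

lemma vert_pos_relpowp:
  "(cube_adj ^^ n) u v \<Longrightarrow> circ_near (real n) (vert_pos u) (vert_pos v)"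
proof (induction n arbitrary: v)
  case 0
  then show ?case by (auto intro: circ_nearI)
next
  case (Suc n)
  then obtain w where "(cube_adj ^^ n) u w" "cube_adj w v" by (auto simp: OO_def)
  then show ?case
    using circ_near_trans[OF Suc.IH vert_pos_cube_adj] by (simp add: add.commute)
qed

lemma cube_connected:
  assumes "u < 8" "v < 8"
  shows "cube_adj\<^sup>*\<^sup>* u v"
proof -
  \<comment> \<open>A spanning tree of the cube rooted at 0.\<close>
  have edges: "cube_adj 0 1" "cube_adj 0 2" "cube_adj 1 3" "cube_adj 0 4"
    "cube_adj 1 5" "cube_adj 2 6" "cube_adj 3 7"
    by (simp_all add: cube_adj_iff)
  have from0: "cube_adj\<^sup>*\<^sup>* 0 v" if "v < 8" for v
    using that by (elim less_8_cases; hypsubst) (meson edges rtranclp.intros)+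
  have "symp cube_adj"
    using cube_adj_commute by (auto intro: sympI)
  then have "cube_adj\<^sup>*\<^sup>* u 0"
    using from0[OF assms(1)] by (meson sympD symp_rtranclp)
  then show ?thesis
    using from0[OF assms(2)] by (rule rtranclp_trans)
qed

lemma vert_pos_gdist:
  "u < 8 \<Longrightarrow> v < 8 \<Longrightarrow> circ_near (real (gdist cube_adj u v)) (vert_pos u) (vert_pos v)"
  by (intro vert_pos_relpowp relpowp_gdist cube_connected)

text \<open>Since \<open>edge_dir\<close> has absolute value at most 1, moving from \<open>p\<close>
  to an end of its edge displaces the projection by at most the distance travelled.\<close>

lemma circ_pos_ends:
  assumes "p \<in> mg_points cube_V cube_adj" "(x, a) \<in> ends p"
  shows "x < 8" "circ_near a (circ_pos p) (vert_pos x)"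
proof -
  have "x < 8 \<and> circ_near a (circ_pos p) (vert_pos x)"
  proof (cases p)
    case (Vert v)
    then show ?thesis using assms by (auto simp: mg_points_def cube_V_def intro: circ_nearI)
  next
    case (Mid u v t)
    then have e: "u < 8" "v < 8" "u < v" "cube_adj u v" "0 < t" "t < 1"
      using assms(1) by (auto simp: mg_points_def cube_V_def)
    note dir = edge_dir_cube[OF e(4,3)]
    have scaled: "\<bar>r * edge_dir u v\<bar> \<le> r" if "0 \<le> r" for r
      using dir(1) that by (simp add: abs_mult mult_left_le)
    have "circ_near t (circ_pos p) (vert_pos u)"
      using scaled[of t] e Mid by (intro circ_nearI) simp
    moreover have "circ_near (1 - t) (circ_pos p) (vert_pos u + edge_dir u v)"
      using scaled[of "1 - t"] e Mid by (intro circ_nearI) (simp add: algebra_simps abs_minus_commute)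
    then have "circ_near (1 - t) (circ_pos p) (vert_pos v)"
      using circ_near_trans[OF _ dir(2)] by fastforce
    ultimately show ?thesis using assms(2) e Mid by auto
  qed
  then show "x < 8" "circ_near a (circ_pos p) (vert_pos x)" by auto
qed

text \<open>The distance is attained by one of its candidates. On a common edge the slope bound
  suffices; on a route through ends \<open>x\<close> and \<open>y\<close> the bounds for the three
  stretches of lengths \<open>a\<close>, \<open>gdist\<close> and \<open>b\<close> add up.\<close>

lemma circ_pos_lipschitz:
  assumes p: "p \<in> mg_points cube_V cube_adj" and q: "q \<in> mg_points cube_V cube_adj"
  shows "circ_near (mg_dist cube_adj p q) (circ_pos p) (circ_pos q)"
proof (cases rule: mg_dist_cases[of cube_adj p q])
  case 1
  then obtain u v s t where [simp]: "p = Mid u v s" "q = Mid u v t"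
    and d: "mg_dist cube_adj p q = \<bar>s - t\<bar>"
    by (cases p; cases q) (auto split: if_splits)
  have "cube_adj u v" "u < v" using p by (auto simp: mg_points_def)
  then have "\<bar>(s - t) * edge_dir u v\<bar> \<le> \<bar>s - t\<bar>"
    using edge_dir_cube(1) by (simp add: abs_mult mult_left_le)
  then show ?thesis
    unfolding d by (intro circ_nearI) (simp add: algebra_simps)
next
  case (2 x a y b)
  note px = circ_pos_ends[OF p 2(1)] and qy = circ_pos_ends[OF q 2(2)]
  show ?thesis
    unfolding 2(3)
    by (intro circ_near_trans[OF circ_near_trans[OF px(2) vert_pos_gdist[OF px(1) qy(1)]]]
        circ_near_sym[OF qy(2)])
qed

lemma circ_pos_surj:
  obtains p where "p \<in> mg_points cube_V cube_adj" "circ_near 0 (circ_pos p) r"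
proof -
  define k where "k = \<lfloor>r / 4\<rfloor>"
  define x where "x = r - 4 * of_int k"
  have x: "0 \<le> x" "x < 4"
    unfolding x_def k_def by linarith+
  \<comment> \<open>The face with third bit 0: its vertices 0, 1, 3, 2 lie at positions 0, 1, 2, 3,
    so its boundary runs once around the circle.\<close>
  have edges: "cube_adj 0 1" "cube_adj 1 3" "cube_adj 2 3" "cube_adj 0 2"
    by (simp_all add: cube_adj_iff)
  have "\<exists>p \<in> mg_points cube_V cube_adj. circ_pos p = x \<or> circ_pos p = x - 4"
  proof -
    consider "x = 0" | "x = 1" | "x = 2" | "x = 3"
      | "0 < x" "x < 1" | "1 < x" "x < 2" | "2 < x" "x < 3" | "3 < x" "x < 4"
      using x by linarith
    then show ?thesis
    proof cases
      case 1 then show ?thesis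
        by (intro bexI[of _ "Vert 0"]) (auto simp: mg_points_def cube_V_def vert_pos_def)
    next
      case 2 then show ?thesis
        by (intro bexI[of _ "Vert 1"]) (auto simp: mg_points_def cube_V_def vert_pos_def)
    next
      case 3 then show ?thesis
        by (intro bexI[of _ "Vert 3"]) (auto simp: mg_points_def cube_V_def vert_pos_def)
    next
      case 4 then show ?thesis
        by (intro bexI[of _ "Vert 2"]) (auto simp: mg_points_def cube_V_def vert_pos_def)
    next
      case 5 then show ?thesis using edges
        by (intro bexI[of _ "Mid 0 1 x"])
          (auto simp: mg_points_def cube_V_def vert_pos_def edge_dir_def)
    next
      case 6 then show ?thesis using edges
        by (intro bexI[of _ "Mid 1 3 (x - 1)"])
          (auto simp: mg_points_def cube_V_def vert_pos_def edge_dir_def)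
    next
      \<comment> \<open>On the edges 2-3 and 0-2 the projection runs backwards, hence the parameters
        \<open>3 - x\<close> and \<open>4 - x\<close>; the latter gives the position
        \<open>x - 4\<close>.\<close>
      case 7 then show ?thesis using edges
        by (intro bexI[of _ "Mid 2 3 (3 - x)"])
          (auto simp: mg_points_def cube_V_def vert_pos_def edge_dir_def)
    next
      case 8 then show ?thesis using edges
        by (intro bexI[of _ "Mid 0 2 (4 - x)"])
          (auto simp: mg_points_def cube_V_def vert_pos_def edge_dir_def)
    qed
  qed
  then obtain p where p: "p \<in> mg_points cube_V cube_adj" "circ_pos p = x \<or> circ_pos p = x - 4"
    by blast
  from p(2) have "circ_near 0 (circ_pos p) r"
  proof
    assume "circ_pos p = x" then show ?thesis
      unfolding circ_near_def by (intro exI[of _ k]) (simp add: x_def)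
  next
    assume "circ_pos p = x - 4" then show ?thesis
      unfolding circ_near_def by (intro exI[of _ "k + 1"]) (simp add: x_def)
  qed
  with p(1) show thesis by (rule that)
qed

section \<open>Lifting from the icosahedron to the line\<close>

lemma ico_edges_eq: "ico_edges = {(11,6), (11,7), (11,8), (11,9), (11,10),
    (1,7), (2,8), (3,9), (4,10), (5,6), (1,6), (2,7), (3,8), (4,9), (5,10),
    (6,7), (7,8), (8,9), (9,10), (10,6), (1,2), (2,3), (3,4), (4,5), (5,1),
    (0,1), (0,2), (0,3), (0,4), (0,5)}"
proof -
  have "{1..5::nat} = {1, 2, 3, 4, 5}" "{6..10::nat} = {6, 7, 8, 9, 10}" by auto
  then show ?thesis
    unfolding ico_edges_def Setcompr_eq_image by (simp flip: numeral_2_eq_2)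
qed

lemma ico_adj_commute: "ico_adj u v \<longleftrightarrow> ico_adj v u"
  by (auto simp: ico_adj_def)

lemma ico_adj_cases: "ico_adj u v \<Longrightarrow> P u v" if
  "\<And>u v. P u v \<Longrightarrow> P v u" "\<forall>(u, v) \<in> ico_edges. P u v"
  using that by (auto simp: ico_adj_def)

lemma ico_adj_less_12:
  assumes "ico_adj u v"
  shows "u < 12" "v < 12" "u \<noteq> v"
  using assms by (auto simp: ico_adj_def ico_edges_eq)

text \<open>The opposite vertex of the icosahedron, the only one at graph distance 3; meaningful for
  \<open>v < 12\<close>.\<close>

definition antipode :: "nat \<Rightarrow> nat" where
  "antipode v = [11, 9, 10, 6, 7, 8, 3, 4, 5, 1, 2, 0] ! v"

lemma less_12_cases:
  assumes "(u::nat) < 12"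
  obtains "u = 0" | "u = 1" | "u = 2" | "u = 3" | "u = 4" | "u = 5" | "u = 6" | "u = 7"
    | "u = 8" | "u = 9" | "u = 10" | "u = 11"
proof -
  consider "u < 8" | "u = 8" | "u = 9" | "u = 10" | "u = 11"
    using assms by linarith
  then show thesis
    by cases (erule less_8_cases, (erule that)+)
qed

lemma ico_adj_exists:
  assumes "u < 12"
  shows "\<exists>w. ico_adj u w"
proof -
  \<comment> \<open>The apices 0 and 11 are adjacent to all of their pentagons, while 1 and 6 serve
    as neighbours of the apices themselves.\<close>
  have "\<exists>w \<in> {0, 1, 6, 11}. ico_adj u w"
    using assms by (elim less_12_cases) (simp_all add: ico_adj_def ico_edges_eq)
  then show ?thesis by blast
qed

lemma antipode_inj: "u < 12 \<Longrightarrow> v < 12 \<Longrightarrow> antipode u = antipode v \<Longrightarrow> u = v"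
proof -
  have invol: "antipode (antipode u) = u" if "u < 12" for u
    using that by (elim less_12_cases) (simp_all add: antipode_def)
  show "u < 12 \<Longrightarrow> v < 12 \<Longrightarrow> antipode u = antipode v \<Longrightarrow> u = v"
    using invol by metis
qed

text \<open>Distinct vertices that are not antipodal are joined by two edges. For an antipodal pair,
  step first to a neighbour \<open>w\<close> of \<open>u\<close>: antipodes are unique, so
  \<open>v\<close> is not antipodal to \<open>w\<close> and the total is 1 + 2.\<close>

lemma ico_lipschitz_diam:
  fixes G :: "nat \<Rightarrow> real"
  assumes G: "\<And>u v. ico_adj u v \<Longrightarrow> \<bar>G u - G v\<bar> \<le> 1" and uv: "u < 12" "v < 12"
  shows "\<bar>G u - G v\<bar> \<le> 3" "v \<noteq> antipode u \<Longrightarrow> \<bar>G u - G v\<bar> \<le> 2"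
proof -
  have two_steps: "\<bar>G u - G v\<bar> \<le> 2" if "ico_adj u w" "ico_adj w v" for u v w
    using G[OF that(1)] G[OF that(2)] by linarith
  \<comment> \<open>Adjacent vertices are covered by the last alternative too, because every edge
    lies in a triangle.\<close>
  have "v = antipode u \<or> u = v \<or> (\<exists>w. ico_adj u w \<and> ico_adj w v)" if "u < 12" "v < 12" for u v
  proof -
    have "v = antipode u \<or> u = v \<or> (\<exists>w \<in> {0, 1, 2, 3, 4, 5, 6, 7, 8, 9, 10, 11}. ico_adj u w \<and> ico_adj w v)"
      using that
      by (elim less_12_cases; simp add: antipode_def ico_adj_def ico_edges_eq)
    then show ?thesis by blast
  qed
  then have far: "\<bar>G u - G v\<bar> \<le> 2" if "u < 12" "v < 12" "v \<noteq> antipode u" for u v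
    using two_steps that by fastforce
  then show "v \<noteq> antipode u \<Longrightarrow> \<bar>G u - G v\<bar> \<le> 2" using uv by blast
  obtain w where w: "ico_adj u w" using ico_adj_exists[OF uv(1)] by blast
  have wv: "w < 12" "w \<noteq> u" using ico_adj_less_12[OF w] by auto
  show "\<bar>G u - G v\<bar> \<le> 3"
  proof (cases "v = antipode u")
    case True
    then have "v \<noteq> antipode w" using antipode_inj[OF uv(1) wv(1)] wv by auto
    then show ?thesis using far[OF wv(1) uv(2)] G[OF w] by linarith
  next
    case False
    then show ?thesis using far[OF uv] by linarith
  qed
qed

text \<open>The lift is built along a spanning tree: from 0 to the upper pentagon, from each
  \<open>i - 5\<close> down to \<open>i\<close> in the lower pentagon, and from 6 to 11. Each of the
  other 19 edges closes a triangular face whose other two edges are already bounded.\<close>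

lemma ico_lift:
  fixes g :: "nat \<Rightarrow> real"
  assumes g: "\<And>u v. ico_adj u v \<Longrightarrow> circ_near 1 (g u) (g v)"
  obtains G where "\<And>v. v < 12 \<Longrightarrow> circ_near 0 (G v) (g v)"
    "\<And>u v. ico_adj u v \<Longrightarrow> \<bar>G u - G v\<bar> \<le> 1"
proof -
  have adj: "ico_adj u v" if "(u, v) \<in> ico_edges \<or> (v, u) \<in> ico_edges" for u v
    using that by (simp add: ico_adj_def)
  have lift: "\<exists>A. circ_near 0 A (g u) \<and> \<bar>A - B\<bar> \<le> 1" if "ico_adj u v" "circ_near 0 B (g v)" for u v B
    using circ_near_lift[OF g[OF that(1)] that(2)] by blast
  \<comment> \<open>The two known sides give \<open>\<bar>A - B\<bar> \<le> 2\<close>, and 2 + 1 <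
    4, so the lifts agree around the triangle.\<close>
  have triangle: "\<bar>A - B\<bar> \<le> 1"
    if "ico_adj u v" "circ_near 0 A (g u)" "circ_near 0 B (g v)" "\<bar>A - C\<bar> \<le> 1" "\<bar>B - C\<bar> \<le> 1" for u v A B C
    by (rule circ_near_lift_unique[OF g[OF that(1)] that(2,3)]) (use that(4,5) in linarith)
  have l0: "circ_near 0 (g 0) (g 0)" by (intro circ_nearI) simp
  have "ico_adj i 0" if "i \<in> {1, 2, 3, 4, 5}" for i
    using that by (intro adj) (auto simp: ico_edges_eq)
  then have "\<forall>i \<in> {1, 2, 3, 4, 5}. \<exists>A. circ_near 0 A (g i) \<and> \<bar>A - g 0\<bar> \<le> 1"
    by (intro ballI lift[OF _ l0])
  from bchoice[OF this] obtain U
    where U: "\<forall>i \<in> {1, 2, 3, 4, 5}. circ_near 0 (U i) (g i) \<and> \<bar>U i - g 0\<bar> \<le> 1" by (elim exE)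
  have "ico_adj i (i - 5) \<and> circ_near 0 (U (i - 5)) (g (i - 5))" if "i \<in> {6, 7, 8, 9, 10}" for i
    using that U adj by (elim insertE emptyE) (simp_all add: ico_edges_eq)
  then have "\<forall>i \<in> {6, 7, 8, 9, 10}. \<exists>A. circ_near 0 A (g i) \<and> \<bar>A - U (i - 5)\<bar> \<le> 1"
    using lift by (metis (no_types, lifting))
  from bchoice[OF this] obtain W
    where W: "\<forall>i \<in> {6, 7, 8, 9, 10}. circ_near 0 (W i) (g i) \<and> \<bar>W i - U (i - 5)\<bar> \<le> 1" by (elim exE)
  have "ico_adj 11 6"
    by (intro adj) (simp add: ico_edges_eq)
  then have "\<exists>A. circ_near 0 A (g 11) \<and> \<bar>A - W 6\<bar> \<le> 1"
    using W by (intro lift[of _ 6]) simp_all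
  then obtain T where T: "circ_near 0 T (g 11)" "\<bar>T - W 6\<bar> \<le> 1" by blast
  define G where "G = (\<lambda>i. if i = 0 then g 0 else if i \<le> 5 then U i else if i \<le> 10 then W i else T)"
  have near: "circ_near 0 (G v) (g v)" if "v < 12" for v
    using that U W T l0 by (elim less_12_cases) (simp_all add: G_def)
  have tri: "\<bar>G u - G v\<bar> \<le> 1"
    if "(u, v) \<in> ico_edges \<or> (v, u) \<in> ico_edges" "\<bar>G u - G w\<bar> \<le> 1" "\<bar>G v - G w\<bar> \<le> 1" for u v w
    using triangle[OF adj[OF that(1)] near near that(2,3)] ico_adj_less_12[OF adj[OF that(1)]] by blast
  have top: "\<bar>G 1 - G 0\<bar> \<le> 1" "\<bar>G 2 - G 0\<bar> \<le> 1" "\<bar>G 3 - G 0\<bar> \<le> 1" "\<bar>G 4 - G 0\<bar> \<le> 1" "\<bar>G 5 - G 0\<bar> \<le> 1"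
    using U by (simp_all add: G_def)
  have side: "\<bar>G 6 - G 1\<bar> \<le> 1" "\<bar>G 7 - G 2\<bar> \<le> 1" "\<bar>G 8 - G 3\<bar> \<le> 1" "\<bar>G 9 - G 4\<bar> \<le> 1" "\<bar>G 10 - G 5\<bar> \<le> 1"
    using W by (simp_all add: G_def)
  \<comment> \<open>The faces at the apex 0 close the upper pentagon; the faces of the antiprism
    band then give first the slanted edges and after them the lower pentagon.\<close>
  have upper: "\<bar>G 1 - G 2\<bar> \<le> 1" "\<bar>G 2 - G 3\<bar> \<le> 1" "\<bar>G 3 - G 4\<bar> \<le> 1" "\<bar>G 4 - G 5\<bar> \<le> 1" "\<bar>G 5 - G 1\<bar> \<le> 1"
    by (rule tri[OF _ top(1) top(2)] tri[OF _ top(2) top(3)] tri[OF _ top(3) top(4)] tri[OF _ top(4) top(5)] tri[OF _ top(5) top(1)]; simp add: ico_edges_eq)+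
  have cross: "\<bar>G 7 - G 1\<bar> \<le> 1" "\<bar>G 8 - G 2\<bar> \<le> 1" "\<bar>G 9 - G 3\<bar> \<le> 1" "\<bar>G 10 - G 4\<bar> \<le> 1" "\<bar>G 6 - G 5\<bar> \<le> 1"
    by (rule tri[OF _ side(2) upper(1)] tri[OF _ side(3) upper(2)] tri[OF _ side(4) upper(3)] tri[OF _ side(5) upper(4)] tri[OF _ side(1) upper(5)]; simp add: ico_edges_eq)+
  have lower: "\<bar>G 7 - G 6\<bar> \<le> 1" "\<bar>G 8 - G 7\<bar> \<le> 1" "\<bar>G 9 - G 8\<bar> \<le> 1" "\<bar>G 10 - G 9\<bar> \<le> 1" "\<bar>G 6 - G 10\<bar> \<le> 1"
    by (rule tri[OF _ cross(1) side(1)] tri[OF _ cross(2) side(2)] tri[OF _ cross(3) side(3)] tri[OF _ cross(4) side(4)] tri[OF _ cross(5) side(5)]; simp add: ico_edges_eq)+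
  have b6: "\<bar>G 11 - G 6\<bar> \<le> 1" using T by (simp add: G_def)
  \<comment> \<open>Starting at the tree edge 11-6, successive faces around 11 bound one further
    spoke each.\<close>
  have b7: "\<bar>G 11 - G 7\<bar> \<le> 1"
    by (rule tri[OF _ b6 lower(1)]) (simp add: ico_edges_eq)
  have b8: "\<bar>G 11 - G 8\<bar> \<le> 1"
    by (rule tri[OF _ b7 lower(2)]) (simp add: ico_edges_eq)
  have b9: "\<bar>G 11 - G 9\<bar> \<le> 1"
    by (rule tri[OF _ b8 lower(3)]) (simp add: ico_edges_eq)
  have b10: "\<bar>G 11 - G 10\<bar> \<le> 1"
    by (rule tri[OF _ b9 lower(4)]) (simp add: ico_edges_eq)
  have "\<bar>G u - G v\<bar> \<le> 1" if "ico_adj u v" for u v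
  proof (rule ico_adj_cases[OF _ _ that])
    show "\<forall>(u, v) \<in> ico_edges. \<bar>G u - G v\<bar> \<le> 1"
      using top side upper cross lower b6 b7 b8 b9 b10
      by (simp add: ico_edges_eq abs_minus_commute)
  qed (simp add: abs_minus_commute)
  with near show thesis by (rule that)
qed

text \<open>Constraints on a lifted value \<open>x\<close> of a point at distance \<open>s\<close>
  from \<open>u\<close> on the edge \<open>u\<close>-\<open>v\<close>. They force \<open>s\<close>
  into [0,1], and a vertex is the case \<open>s = 0\<close>.\<close>

definition edge_close :: "(nat \<Rightarrow> real) \<Rightarrow> real \<Rightarrow> bool" where
  "edge_close G x \<longleftrightarrow> (\<exists>u v s. ico_adj u v \<and> \<bar>x - G u\<bar> \<le> s \<and> \<bar>x - G v\<bar> \<le> 1 - s)"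

text \<open>Pair the ends of the two edges so that neither pair is antipodal. Going through one
  pair, \<open>\<bar>x - y\<bar>\<close> is at most 2 plus the two distances to these ends; going
  through the other, 2 plus the complementary distances. The two bounds add up to 6, so their mean
  is 3.\<close>

lemma edge_close_diam:
  assumes G: "\<And>u v. ico_adj u v \<Longrightarrow> \<bar>G u - G v\<bar> \<le> 1"
    and "edge_close G x" "edge_close G y"
  shows "\<bar>x - y\<bar> \<le> 3"
proof -
  obtain u v s where x: "ico_adj u v" "\<bar>x - G u\<bar> \<le> s" "\<bar>x - G v\<bar> \<le> 1 - s"
    using assms(2) by (auto simp: edge_close_def)
  obtain u' v' t where y: "ico_adj u' v'" "\<bar>y - G u'\<bar> \<le> t" "\<bar>y - G v'\<bar> \<le> 1 - t"
    using assms(3) by (auto simp: edge_close_def)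
  note lt = ico_adj_less_12[OF x(1)] ico_adj_less_12[OF y(1)]
  note d = ico_lipschitz_diam[of G, OF G]
  \<comment> \<open>If one of the two pairings contains an antipodal pair, injectivity of
    \<open>antipode\<close> and distinctness of the ends of an edge keep the other pairing free of
    them.\<close>
  have "(u' \<noteq> antipode u \<and> v' \<noteq> antipode v) \<or> (v' \<noteq> antipode u \<and> u' \<noteq> antipode v)"
    using lt antipode_inj by metis
  then show ?thesis
  proof
    assume "u' \<noteq> antipode u \<and> v' \<noteq> antipode v"
    then have "\<bar>G u - G u'\<bar> \<le> 2" "\<bar>G v - G v'\<bar> \<le> 2" using d(2) lt by blast+
    then show ?thesis using x y by linarith
  next
    assume "v' \<noteq> antipode u \<and> u' \<noteq> antipode v"
    then have "\<bar>G u - G v'\<bar> \<le> 2" "\<bar>G v - G u'\<bar> \<le> 2" using d(2) lt by blast+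
    then show ?thesis using x y by linarith
  qed
qed

section \<open>A set of diameter 3 cannot cover the circle of length 4\<close>

theorem theorem2:
  shows "\<not> (\<exists>m. isometric_covering
                 (mg_points ico_V ico_adj) (mg_dist ico_adj)
                 (mg_points cube_V cube_adj) (mg_dist cube_adj) m)"
proof
  assume "\<exists>m. isometric_covering
                 (mg_points ico_V ico_adj) (mg_dist ico_adj)
                 (mg_points cube_V cube_adj) (mg_dist cube_adj) m"
  then obtain m where m: "isometric_covering
                 (mg_points ico_V ico_adj) (mg_dist ico_adj)
                 (mg_points cube_V cube_adj) (mg_dist cube_adj) m" by blast
  let ?I = "mg_points ico_V ico_adj" and ?C = "mg_points cube_V cube_adj"
  have onto: "m ` ?I = ?C" using m by (simp add: isometric_covering_def)
  define g where "g = circ_pos \<circ> m"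
  have V: "v \<in> ico_V \<longleftrightarrow> v < 12" for v by (auto simp: ico_V_def)
  \<comment> \<open>Both the covering on an edge and the projection of the cube do not increase
    distances, hence neither does their composition \<open>g\<close>.\<close>
  have g_edge: "circ_near \<bar>b - a\<bar> (g (edge_pt u v a)) (g (edge_pt u v b))"
    if e: "ico_adj u v" "u < v" and ab: "a \<in> {0..1}" "b \<in> {0..1}" for u v a b
  proof -
    have uv: "u \<in> ico_V" "v \<in> ico_V" "ico_adj v u"
      using ico_adj_less_12[OF e(1)] e ico_adj_commute V by auto
    have "m (edge_pt u v t) \<in> ?C" for t
      using edge_pt_in_mg_points[OF uv(1,2) e(2), where E = ico_adj] e(1) onto by blast
    then have "circ_near (mg_dist cube_adj (m (edge_pt u v a)) (m (edge_pt u v b)))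
        (g (edge_pt u v a)) (g (edge_pt u v b))"
      unfolding g_def comp_def by (intro circ_pos_lipschitz)
    then show ?thesis
      by (rule circ_near_mono) (rule covering_lipschitz_on_edge[OF m uv(1,2) e(2,1) uv(3) ab])
  qed
  have "circ_near 1 (g (Vert u)) (g (Vert v))" if "ico_adj u v" for u v
  proof -
    have *: "circ_near 1 (g (Vert u)) (g (Vert v))" if "ico_adj u v" "u < v" for u v
      using g_edge[OF that, of 0 1] by (simp add: edge_pt_def)
    show ?thesis
      using *[of u v] circ_near_sym[OF *[of v u]] ico_adj_less_12(3)[OF that] that ico_adj_commute
      by (meson nat_neq_iff)
  qed
  then obtain G where G: "\<And>v. v < 12 \<Longrightarrow> circ_near 0 (G v) (g (Vert v))"
    "\<And>u v. ico_adj u v \<Longrightarrow> \<bar>G u - G v\<bar> \<le> 1"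
    using ico_lift[of "\<lambda>v. g (Vert v)"] by blast
  have lift: "\<exists>x. circ_near 0 x (g p) \<and> edge_close G x" if p: "p \<in> ?I" for p
  proof (cases p)
    case (Vert v)
    then have v: "v < 12" using p by (auto simp: mg_points_def V)
    obtain w where "ico_adj v w" using ico_adj_exists[OF v] by blast
    then have "edge_close G (G v)"
      unfolding edge_close_def using G(2) by (intro exI[of _ v] exI[of _ w] exI[of _ 0]) auto
    then show ?thesis using G(1)[OF v] Vert by blast
  next
    case (Mid u v s)
    then have e: "u < 12" "v < 12" "u < v" "ico_adj u v" "0 < s" "s < 1"
      using p by (auto simp: mg_points_def V)
    have pu: "circ_near s (g p) (g (Vert u))"
      using circ_near_sym[OF g_edge[OF e(4,3), of 0 s]] e Mid by (simp add: edge_pt_def)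
    have pv: "circ_near (1 - s) (g p) (g (Vert v))"
      using g_edge[OF e(4,3), of s 1] e Mid by (simp add: edge_pt_def)
    obtain x where x: "circ_near 0 x (g p)" "\<bar>x - G u\<bar> \<le> s"
      using circ_near_lift[OF pu G(1)[OF e(1)]] by blast
    \<comment> \<open>The lift \<open>x\<close> was chosen near \<open>G u\<close> only. It
      satisfies \<open>\<bar>x - G v\<bar> \<le> s + 1\<close>, and (s + 1) + (1 - s) = 2 < 4, so
      uniqueness of lifts gives the bound at the other end as well.\<close>
    have "\<bar>x - G v\<bar> \<le> 1 - s"
      using circ_near_lift_unique[OF pv x(1) G(1)[OF e(2)]] x(2) G(2)[OF e(4)] e by linarith
    then show ?thesis using x e(4) unfolding edge_close_def by blast
  qed
  define S where "S = {x. edge_close G x}"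
  have diam: "\<bar>x - y\<bar> \<le> 3" if "x \<in> S" "y \<in> S" for x y
    using edge_close_diam[OF G(2)] that by (simp add: S_def)
  \<comment> \<open>Both \<open>m\<close> and the projection to the circle are onto, so
    \<open>S\<close> meets every class modulo 4.\<close>
  have covered: "\<exists>x \<in> S. circ_near 0 x r" for r
  proof -
    obtain q where q: "q \<in> ?C" "circ_near 0 (circ_pos q) r" by (rule circ_pos_surj)
    then obtain p where "p \<in> ?I" "q = m p" using onto by blast
    then obtain x where "circ_near 0 x (circ_pos q)" "x \<in> S"
      using lift by (auto simp: g_def S_def)
    then show ?thesis using circ_near_trans[OF _ q(2)] by fastforce
  qed
  then obtain y where y: "y \<in> S" by blast
  have bdd: "bdd_below S"
    by (rule bdd_belowI[of _ "y - 3"]) (use diam[OF _ y] in \<open>fastforce simp: abs_le_iff\<close>)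
  define a where "a = Inf S"
  have lower: "a \<le> x" if "x \<in> S" for x
    unfolding a_def using that bdd by (rule cInf_lower)
  have upper: "x - 3 \<le> a" if "x \<in> S" for x
    unfolding a_def using y diam[OF that] by (intro cInf_greatest) (fastforce simp: abs_le_iff)+
  \<comment> \<open>\<open>S\<close> lies in [a, a + 3], and \<open>a + 7 / 2\<close> is the
    midpoint of the gap between \<open>a + 3\<close> and \<open>a + 4\<close>; none of its
    translates by multiples of 4 falls into that interval.\<close>
  obtain x where x: "x \<in> S" "circ_near 0 x (a + 7 / 2)" using covered by blast
  then obtain k :: int where "x - (a + 7 / 2) + 4 * of_int k = 0"
    by (auto simp: circ_near_def)
  with lower[OF x(1)] upper[OF x(1)] have "0 < real_of_int k" "real_of_int k < 1"
    by linarith+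
  then show False by simp
qed

end
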